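(* Let $f,g,h,h_1,\dots,h_n:M\to K$ be functions satisfying $$f(xy)=g(x)h(y)+\sum_{j=1}^{n}g_j(x)h_j(y)\qquad\text{for all }x,y\in M.$$ Then $(f,g,h,h_1,\dots,h_n)$ has one of the following forms: (1) $f=ab\chi$, $\;g=b\chi-\sum_{k=1}^{n}c_kg_k$, $\;h=a\chi$, $\;h_j=ac_j\chi$ for $j=1,\dots,n$, where $\chi:M\to K$ is a nonzero multiplicative function with $\chi\neq\mu_i$ for all $i\in\{1,\dots,m\}$, $a,b\in K^{*}$, and $c_1,\dots,c_n\in K$. (2) There exist a unique $q\in\{1,\dots,n\}$ and constants $a,b,c,d\in K$ and $c_j\in K$ for $j\in\{1,\dots,n\}\setminus\{q\}$, with $c\neq d$ and $(a,b)\neq(0,0)$, such that: - if $m_q-n_q=1$, then $$f=(d-c)\left(b\,b_{n_q}\mu_{n_q}-a\,b_{m_q}\mu_{m_q}\right),$$ $$g=d\,b_{n_q}\mu_{n_q}+c\,b_{m_q}\mu_{m_q}+\sum_{j=1,\,j\neq q}^{n}c_jg_j,$$ $$h=a\mu_{m_q}+b\mu_{n_q},\qquad h_q=-da\,\mu_{m_q}-cb\,\mu_{n_q},$$ $$h_j=-c_ja\,\mu_{m_q}-c_jb\,\mu_{n_q}\quad\text{for all }j\in\{1,\dots,n\}\setminus\{q\};$$ - if $m_q-n_q\geq 2$, then for some $k\in\{n_q,\dots,m_q\}$, and with $a\neq0$, $$f=a(c-d)b_k\mu_k,\qquad g=dg_q+(c-d)b_k\mu_k+\sum_{j=1,\,j\neq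 q}^{n}c_jg_j,$$ $$h=a\mu_k,\qquad h_q=-da\,\mu_k,\qquad h_j=-c_ja\,\mu_k\quad\text{for all }j\in\{1,\dots,n\}\setminus\{q\}.$$ (3) $f=0$, $\;g=\sum_{k=1}^{n}c_kg_k$, $\;h:M\to K$ is any nonzero function (i.e. not identically zero), and $h_j=-c_jh$ for all $j\in\{1,\dots,n\}$, where $c_1,\dots,c_n\in K$. (4) $f=0$, $\;g:M\to K$ is any function, and $h=h_j=0$ for all $j\in\{1,\dots,n\}$.
   Context: $M$ is a monoid (a semigroup with neutral element $e$, not necessarily commutative), $K$ is a field, and $K^{*}=K\setminus\{0\}$. A multiplicative function is a map $\mu:M\to K$ with $\mu(xy)=\mu(x)\mu(y)$ for all $x,y\in M$; "nonzero" means not identically zero. Let $n\geq2$ be an integer. Let $\mu_1,\dots,\mu_m:M\to K$ be distinct nonzero multiplicative functions, and let $b_1,\dots,b_m\in K$ all be nonzero. The index set $\{1,\dots,m\}$ is partitioned into $n$ consecutive intervals $\{n_j,\dots,m_j\}$, $j=1,\dots,n$, with $n_1=1$, $m_j=n_{j+1}-1$ for $1\leq j\leq n-1$, $m_n=m$, and $m_j-n_j\geq1$ for every $j$ (each interval has at least two elements). For $j=1,\dots,n$ define $g_j=\sum_{i=n_j}^{m_j}b_i\mu_i$. *)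

theory Defs
  imports Complex_Main
begin

definition multiplicative :: "('m::monoid_mult \<Rightarrow> 'k::field) \<Rightarrow> bool" where
  "multiplicative \<mu> \<longleftrightarrow> (\<forall>x y. \<mu> (x * y) = \<mu> x * \<mu> y)"

definition nonzero_multiplicative :: "('m::monoid_mult \<Rightarrow> 'k::field) \<Rightarrow> bool" where
  "nonzero_multiplicative \<mu> \<longleftrightarrow> multiplicative \<mu> \<and> \<mu> \<noteq> (\<lambda>x. 0)"

end

theory Submission
  imports Defs
begin

text \<open>The idea is to compare coefficients of the distinct functions \<open>\<mu> i\<close>, which are linearly
  independent by Dedekind's lemma (\<open>multiplicative_independent\<close>). There are two cases.

  If \<open>f\<close> is not a combination of the \<open>\<mu> i\<close>, then \<open>f\<close> together with the \<open>\<mu> i\<close> is still independent.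
  The equation at \<open>y = 1\<close> expresses \<open>g\<close> by \<open>f\<close> and the block sums, and evaluating
  \<open>f (x * y * z)\<close> in two ways shows that \<open>f\<close> is a multiple of a new multiplicative function
  (\<open>outside_span\<close>). This is the first form.

  If \<open>f\<close> is a combination of the \<open>\<mu> i\<close> and \<open>h\<close> is not zero, then \<open>g\<close> is a combination as well. With
  \<open>f = (\<Sum>i. \<psi> i * \<beta> i * \<mu> i)\<close> and \<open>g = (\<Sum>i. \<delta> i * \<beta> i * \<mu> i)\<close> the functional equation becomes
  \<open>\<psi> i * \<mu> i = \<delta> i * h + hj (blk i)\<close> for every \<open>i\<close>, where \<open>blk i\<close> is the block of \<open>i\<close>
  (\<open>in_span_coefficients\<close>). A block contains at least two indices, and the difference of the relations
  of two indices in one block is \<open>\<psi> i * \<mu> i - \<psi> i' * \<mu> i' = (\<delta> i - \<delta> i') * h\<close>. If \<open>\<delta>\<close> is constant on every block, all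
  \<open>\<psi> i\<close> vanish, which is the third form. Otherwise \<open>h\<close> is a combination of two \<open>\<mu> i\<close> from one block;
  as \<open>h\<close> is the same function for all blocks, \<open>\<delta>\<close> is constant on all the others, so \<open>f\<close> is
  supported on that one block (\<open>jump_case\<close>). This is the second form: a block with two elements
  leaves both coefficients of \<open>h\<close> free, whereas a larger block forces \<open>h\<close> to be a multiple of a
  single \<open>\<mu> k\<close>. If \<open>h\<close> is zero, everything except \<open>g\<close> vanishes, which is the fourth form.\<close>

section \<open>Linear independence of multiplicative functions\<close>

lemma nonzero_multiplicative_mult:
  "nonzero_multiplicative \<nu> \<Longrightarrow> \<nu> (x * y) = \<nu> x * \<nu> y"
  by (simp add: nonzero_multiplicative_def multiplicative_def)

text \<open>Dedekind's argument: translating a relation by \<open>y\<close> multiplies its \<open>i\<close>-th coefficient by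
  \<open>\<mu> i y\<close>; subtracting \<open>\<mu> k y\<close> times the relation removes the term \<open>k\<close> and leaves a shorter one.\<close>

lemma multiplicative_independent:
  fixes \<mu> :: "'i \<Rightarrow> 'm::monoid_mult \<Rightarrow> 'k::field"
  assumes "finite I" "\<And>i. i \<in> I \<Longrightarrow> nonzero_multiplicative (\<mu> i)" "inj_on \<mu> I"
    and "\<And>x. (\<Sum>i\<in>I. a i * \<mu> i x) = 0"
  shows "\<forall>i\<in>I. a i = 0"
  using assms
proof (induction I arbitrary: a rule: finite_induct)
  case empty
  then show ?case by simp
next
  case (insert k F)
  have rel: "(\<Sum>i\<in>F. a i * \<mu> i x) = - a k * \<mu> k x" for x
    using insert.prems(3)[of x] insert.hyps by (simp add: eq_neg_iff_add_eq_0 add.commute)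
  have diff: "(\<Sum>i\<in>F. (a i * (\<mu> i y - \<mu> k y)) * \<mu> i x) = 0" for x y
  proof -
    have "(\<Sum>i\<in>F. (a i * (\<mu> i y - \<mu> k y)) * \<mu> i x)
        = (\<Sum>i\<in>F. a i * \<mu> i (x * y) - (a i * \<mu> i x) * \<mu> k y)"
      using insert.prems(1)
      by (intro sum.cong) (auto simp: nonzero_multiplicative_mult algebra_simps)
    also have "\<dots> = (\<Sum>i\<in>F. a i * \<mu> i (x * y)) - (\<Sum>i\<in>F. a i * \<mu> i x) * \<mu> k y"
      by (simp add: sum_subtractf sum_distrib_right)
    also have "\<dots> = 0"
      unfolding rel using insert.prems(1)[of k] by (simp add: nonzero_multiplicative_mult)
    finally show ?thesis .
  qed
  have F0: "a l = 0" if l: "l \<in> F" for l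
  proof -
    have "\<mu> l \<noteq> \<mu> k"
      using insert.hyps insert.prems(2) l by (auto simp: inj_on_def)
    then obtain y where y: "\<mu> l y \<noteq> \<mu> k y" by auto
    have "\<forall>i\<in>F. a i * (\<mu> i y - \<mu> k y) = 0"
      using insert.prems(1,2) diff by (intro insert.IH) auto
    with y l show ?thesis by auto
  qed
  moreover have "a k = 0"
  proof -
    obtain x where "\<mu> k x \<noteq> 0"
      using insert.prems(1)[of k] by (auto simp: nonzero_multiplicative_def)
    then show ?thesis using rel[of x] F0 by simp
  qed
  ultimately show ?case by auto
qed

section \<open>The equation over a finite set of blocks\<close>

text \<open>The map \<open>blk\<close> sends each index to its block. The right-hand side of the functional equation
  is written with one summand for every \<open>i\<close>, which is the form needed to compare coefficients of
  the \<open>\<mu> i\<close>. The assumption \<open>two_in_block\<close> is what drives the whole classification: the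
  same function \<open>hj (blk i)\<close> has to serve two different \<open>\<mu> i\<close>.\<close>

locale block_equation =
  fixes I :: "'i set" and J :: "'j set" and blk :: "'i \<Rightarrow> 'j"
    and \<mu> :: "'i \<Rightarrow> 'm::monoid_mult \<Rightarrow> 'k::field" and \<beta> :: "'i \<Rightarrow> 'k"
    and f g h :: "'m \<Rightarrow> 'k" and hj :: "'j \<Rightarrow> 'm \<Rightarrow> 'k"
  assumes finite_I: "finite I" and finite_J: "finite J"
    and mult: "i \<in> I \<Longrightarrow> nonzero_multiplicative (\<mu> i)"
    and inj: "inj_on \<mu> I"
    and \<beta>_nonzero: "i \<in> I \<Longrightarrow> \<beta> i \<noteq> 0"
    and blk_in: "i \<in> I \<Longrightarrow> blk i \<in> J"
    and two_in_block: "j \<in> J \<Longrightarrow> \<exists>i\<in>I. \<exists>i'\<in>I. i \<noteq> i' \<and> blk i = j \<and> blk i' = j"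
    and eq: "f (x * y) = g x * h y + (\<Sum>i\<in>I. hj (blk i) y * \<beta> i * \<mu> i x)"
begin

definition block_sum :: "'j \<Rightarrow> 'm \<Rightarrow> 'k" where
  "block_sum j x = (\<Sum>i\<in>{i\<in>I. blk i = j}. \<beta> i * \<mu> i x)"

lemma sum_block_sum:
  assumes "S \<subseteq> J"
  shows "(\<Sum>j\<in>S. c j * block_sum j x) = (\<Sum>i\<in>{i\<in>I. blk i \<in> S}. c (blk i) * \<beta> i * \<mu> i x)"
proof -
  have "(\<Sum>i\<in>{i\<in>I. blk i \<in> S}. c (blk i) * \<beta> i * \<mu> i x)
      = (\<Sum>j\<in>S. \<Sum>i\<in>{i \<in> {i\<in>I. blk i \<in> S}. blk i = j}. c (blk i) * \<beta> i * \<mu> i x)"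
    using assms finite_I finite_J by (intro sum.group[symmetric]) (auto intro: finite_subset)
  also have "\<dots> = (\<Sum>j\<in>S. c j * block_sum j x)"
    unfolding block_sum_def sum_distrib_left
    by (intro sum.cong refl) (auto simp: mult.assoc)
  finally show ?thesis by simp
qed

lemma sum_block_sum_all:
  "(\<Sum>j\<in>J. c j * block_sum j x) = (\<Sum>i\<in>I. c (blk i) * \<beta> i * \<mu> i x)"
proof -
  have "{i\<in>I. blk i \<in> J} = I" using blk_in by auto
  then show ?thesis using sum_block_sum[of J c x] by simp
qed

lemma coefficients_zero:
  assumes "\<And>x. (\<Sum>i\<in>I. a i * \<mu> i x) = 0"
  shows "\<forall>i\<in>I. a i = 0"
  using finite_I mult inj assms by (rule multiplicative_independent)

lemma coefficients_eq:
  assumes "\<And>x. (\<Sum>i\<in>I. a i * \<mu> i x) = (\<Sum>i\<in>I. b i * \<mu> i x)"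
  shows "\<forall>i\<in>I. a i = b i"
proof -
  have "\<forall>i\<in>I. a i - b i = 0"
  proof (rule coefficients_zero)
    show "(\<Sum>i\<in>I. (a i - b i) * \<mu> i x) = 0" for x
      unfolding left_diff_distrib sum_subtractf assms by (rule diff_self)
  qed
  then show ?thesis by simp
qed

lemma single_term:
  assumes "i \<in> I"
  shows "(\<Sum>l\<in>I. (if l = i then a else 0) * \<mu> l x) = a * \<mu> i x"
proof -
  have "(\<Sum>l\<in>I. (if l = i then a else 0) * \<mu> l x) = (\<Sum>l\<in>I. if l = i then a * \<mu> i x else 0)"
    by (rule sum.cong) auto
  then show ?thesis using finite_I assms by simp
qed

lemma proportional_imp_zero:
  assumes "i \<in> I" "i' \<in> I" "i \<noteq> i'" "\<And>x. a * \<mu> i x = b * \<mu> i' x"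
  shows "a = 0" "b = 0"
proof -
  have "\<forall>l\<in>I. (if l = i then a else 0) = (if l = i' then b else 0)"
    by (rule coefficients_eq) (simp only: single_term assms)
  then show "a = 0" "b = 0"
    using assms(1-3) by auto
qed

section \<open>Functions outside the span of the given multiplicative functions\<close>

lemma value_at_one: "f x = g x * h 1 + (\<Sum>i\<in>I. hj (blk i) 1 * \<beta> i * \<mu> i x)"
  using eq[of x 1] by simp

text \<open>The equation at \<open>y = 1\<close> shows that \<open>h 1\<close> is nonzero, since otherwise \<open>f\<close> would lie in the span.
  So it can be used to eliminate \<open>g\<close>, which gives \<open>f (x * y) = f x * H y + \<dots>\<close> with \<open>H = h / h 1\<close>. Since \<open>f\<close> is independent of the \<open>\<mu> i\<close>,
  associativity of \<open>x * y * z\<close> can be read off coefficient by coefficient: the coefficient of \<open>f\<close> says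
  that \<open>H\<close> is multiplicative, and those of two \<open>\<mu> i\<close> in one block force the remaining term of
  that block to vanish. Hence \<open>f\<close> is a multiple of \<open>H\<close>.\<close>

lemma outside_span:
  assumes out: "\<And>\<phi>. \<not> (\<forall>x. f x = (\<Sum>i\<in>I. \<phi> i * \<mu> i x))"
  shows "\<exists>\<chi> a b c. nonzero_multiplicative \<chi> \<and> (\<forall>i\<in>I. \<chi> \<noteq> \<mu> i) \<and> a \<noteq> 0 \<and> b \<noteq> 0 \<and>
    (\<forall>x. f x = a * b * \<chi> x) \<and>
    (\<forall>x. g x = b * \<chi> x - (\<Sum>j\<in>J. c j * block_sum j x)) \<and>
    (\<forall>x. h x = a * \<chi> x) \<and> (\<forall>j\<in>J. \<forall>x. hj j x = a * c j * \<chi> x)"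
proof -
  have h1: "h 1 \<noteq> 0"
  proof
    assume "h 1 = 0"
    then have "\<forall>x. f x = (\<Sum>i\<in>I. (hj (blk i) 1 * \<beta> i) * \<mu> i x)"
      using value_at_one by simp
    with out[of "\<lambda>i. hj (blk i) 1 * \<beta> i"] show False by blast
  qed
  have indep: "A = 0" "\<And>i. i \<in> I \<Longrightarrow> B i = 0"
    if AB: "\<And>x. A * f x = (\<Sum>i\<in>I. B i * \<mu> i x)" for A B
  proof -
    show A: "A = 0"
    proof (rule ccontr)
      assume A: "A \<noteq> 0"
      have "f x = (\<Sum>i\<in>I. (B i / A) * \<mu> i x)" for x
      proof -
        have "f x = (\<Sum>i\<in>I. B i * \<mu> i x) / A" using AB[of x] A by (simp add: field_simps)
        then show ?thesis by (simp add: sum_divide_distrib)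
      qed
      then show False using out[of "\<lambda>i. B i / A"] by blast
    qed
    have "\<forall>i\<in>I. B i = 0" by (rule coefficients_zero) (simp add: AB[symmetric] A)
    then show "B i = 0" if "i \<in> I" for i using that by blast
  qed
  define H where "H y = h y / h 1" for y
  define D where "D j y = hj j y - hj j 1 * H y" for j y
  have h_H: "h y = h 1 * H y" for y using h1 by (simp add: H_def)
  have fxy: "f (x * y) = f x * H y + (\<Sum>i\<in>I. D (blk i) y * \<beta> i * \<mu> i x)" for x y
  proof -
    have "(\<Sum>i\<in>I. D (blk i) y * \<beta> i * \<mu> i x)
        = (\<Sum>i\<in>I. hj (blk i) y * \<beta> i * \<mu> i x) - (\<Sum>i\<in>I. hj (blk i) 1 * \<beta> i * \<mu> i x) * H y"
      by (simp add: D_def sum_subtractf sum_distrib_left algebra_simps)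
    then show ?thesis
      unfolding eq[of x y] value_at_one[of x] h_H[of y] by (simp add: algebra_simps)
  qed
  have assoc: "(H (y * z) - H y * H z) * f x
      = (\<Sum>i\<in>I. ((D (blk i) y * H z + D (blk i) z * \<mu> i y - D (blk i) (y * z)) * \<beta> i) * \<mu> i x)"
    for x y z
  proof -
    have "f x * H (y * z) + (\<Sum>i\<in>I. D (blk i) (y * z) * \<beta> i * \<mu> i x) = f (x * y * z)"
      using fxy[of x "y * z"] by (simp add: mult.assoc)
    also have "\<dots> = f (x * y) * H z + (\<Sum>i\<in>I. D (blk i) z * \<beta> i * \<mu> i (x * y))"
      by (rule fxy)
    also have "\<dots> = f x * H y * H z + (\<Sum>i\<in>I. D (blk i) y * \<beta> i * \<mu> i x) * H z
        + (\<Sum>i\<in>I. D (blk i) z * \<beta> i * (\<mu> i x * \<mu> i y))"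
      using mult by (simp add: fxy nonzero_multiplicative_mult algebra_simps)
    finally show ?thesis
      by (simp add: sum_subtractf sum.distrib sum_distrib_left algebra_simps)
  qed
  have H_mult: "H (y * z) = H y * H z" for y z
    using indep(1)[OF assoc[of y z]] by simp
  have D_rel: "D (blk i) y * H z + D (blk i) z * \<mu> i y = D (blk i) (y * z)" if "i \<in> I" for i y z
    using indep(2)[OF assoc[of y z] that] \<beta>_nonzero[OF that] by simp
  have D0: "D j z = 0" if "j \<in> J" for j z
  proof -
    obtain i i' where i: "i \<in> I" "i' \<in> I" "i \<noteq> i'" "blk i = j" "blk i' = j"
      using two_in_block[OF \<open>j \<in> J\<close>] by blast
    then have "\<mu> i \<noteq> \<mu> i'" using inj by (auto simp: inj_on_def)
    then obtain y where y: "\<mu> i y \<noteq> \<mu> i' y" by auto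
    have "D j z * \<mu> i y = D j z * \<mu> i' y"
      using D_rel[OF i(1), of y z] D_rel[OF i(2), of y z] i(4,5) by (metis add_left_cancel)
    with y show ?thesis by simp
  qed
  have f_H: "f y = f 1 * H y" for y
    using fxy[of 1 y] D0 blk_in by simp
  have f1: "f 1 \<noteq> 0"
  proof
    assume "f 1 = 0"
    then have "f x = 0" for x using f_H[of x] by simp
    then have "\<forall>x. f x = (\<Sum>i\<in>I. 0 * \<mu> i x)" by simp
    with out[of "\<lambda>i. 0"] show False by blast
  qed
  have "H 1 = 1" using h1 by (simp add: H_def)
  then have "H \<noteq> (\<lambda>x. 0)" by (metis zero_neq_one)
  then have nz: "nonzero_multiplicative H"
    using H_mult by (simp add: nonzero_multiplicative_def multiplicative_def)
  have new: "H \<noteq> \<mu> i" if "i \<in> I" for i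
  proof
    assume "H = \<mu> i"
    then have "\<forall>x. f x = (\<Sum>l\<in>I. (if l = i then f 1 else 0) * \<mu> l x)"
      unfolding single_term[OF that] using f_H by metis
    with out[of "\<lambda>l. if l = i then f 1 else 0"] show False by blast
  qed
  have g_H: "g x = f 1 / h 1 * H x - (\<Sum>j\<in>J. hj j 1 / h 1 * block_sum j x)" for x
  proof -
    have "g x = (f x - (\<Sum>i\<in>I. hj (blk i) 1 * \<beta> i * \<mu> i x)) / h 1"
      using value_at_one[of x] h1 by simp
    also have "\<dots> = f x / h 1 - (\<Sum>i\<in>I. hj (blk i) 1 / h 1 * \<beta> i * \<mu> i x)"
      by (simp add: diff_divide_distrib sum_divide_distrib)
    finally show ?thesis using f_H[of x] unfolding sum_block_sum_all by simp
  qed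
  have hj_H: "hj j x = h 1 * (hj j 1 / h 1) * H x" if "j \<in> J" for j x
    using D0[OF that, of x] h1 by (simp add: D_def)
  have f_H': "f x = h 1 * (f 1 / h 1) * H x" for x
    using f_H[of x] h1 by simp
  have "f 1 / h 1 \<noteq> 0" using f1 h1 by simp
  with nz new g_H hj_H f_H' h_H h1 show ?thesis
    by - (rule exI[of _ H], rule exI[of _ "h 1"], rule exI[of _ "f 1 / h 1"],
        rule exI[of _ "\<lambda>j. hj j 1 / h 1"], blast)
qed

section \<open>Functions inside the span\<close>

text \<open>If \<open>h\<close> vanishes, the coefficients of \<open>f\<close> at two \<open>\<mu> i\<close> of one block make the same
  \<open>hj j\<close> a multiple of both of them.\<close>

lemma in_span_h_zero:
  assumes span: "\<And>x. f x = (\<Sum>i\<in>I. \<phi> i * \<mu> i x)" and h0: "\<And>x. h x = 0"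
  shows "f x = 0" "j \<in> J \<Longrightarrow> hj j x = 0"
proof -
  have "\<forall>i\<in>I. \<phi> i * \<mu> i y = hj (blk i) y * \<beta> i" for y
  proof (rule coefficients_eq)
    fix x
    have "(\<Sum>i\<in>I. \<phi> i * \<mu> i y * \<mu> i x) = f (x * y)"
      unfolding span using mult by (intro sum.cong) (auto simp: nonzero_multiplicative_mult)
    also have "\<dots> = (\<Sum>i\<in>I. hj (blk i) y * \<beta> i * \<mu> i x)"
      by (simp add: eq h0)
    finally show "(\<Sum>i\<in>I. \<phi> i * \<mu> i y * \<mu> i x) = (\<Sum>i\<in>I. hj (blk i) y * \<beta> i * \<mu> i x)" .
  qed
  then have rel: "\<phi> i * \<mu> i y = hj (blk i) y * \<beta> i" if "i \<in> I" for i y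
    using that by blast
  have hj0: "hj j y = 0" if "j \<in> J" for j y
  proof -
    obtain i i' where i: "i \<in> I" "i' \<in> I" "i \<noteq> i'" "blk i = j" "blk i' = j"
      using two_in_block[OF \<open>j \<in> J\<close>] by blast
    have b: "\<beta> i \<noteq> 0" "\<beta> i' \<noteq> 0" using i \<beta>_nonzero by auto
    have "\<phi> i / \<beta> i * \<mu> i x = \<phi> i' / \<beta> i' * \<mu> i' x" for x
      using rel[OF i(1), of x] rel[OF i(2), of x] i(4,5) b by (simp add: field_simps)
    then have "\<phi> i / \<beta> i = 0" using proportional_imp_zero(1)[OF i(1-3)] by blast
    then show ?thesis using rel[OF i(1), of y] i(4) b by simp
  qed
  then show "j \<in> J \<Longrightarrow> hj j x = 0" .
  show "f x = 0" using eq[of x 1] hj0 blk_in h0 by simp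
qed

text \<open>Where \<open>h y\<close> is nonzero the equation can be solved for \<open>g\<close>, so \<open>g\<close> lies in the span
  as well. The coefficients are normalised by \<open>\<beta> i\<close> so that \<open>g\<close> is a combination of the block
  sums precisely when \<open>\<delta>\<close> is constant on blocks.\<close>

lemma in_span_coefficients:
  assumes span: "\<And>x. f x = (\<Sum>i\<in>I. \<phi> i * \<mu> i x)" and h_y0: "h y0 \<noteq> 0"
  obtains \<psi> \<delta> where
    "\<And>x. f x = (\<Sum>i\<in>I. \<psi> i * \<beta> i * \<mu> i x)"
    "\<And>x. g x = (\<Sum>i\<in>I. \<delta> i * \<beta> i * \<mu> i x)"
    "\<And>i y. i \<in> I \<Longrightarrow> \<psi> i * \<mu> i y = \<delta> i * h y + hj (blk i) y"
proof -
  define \<psi> where "\<psi> i = \<phi> i / \<beta> i" for i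
  define \<delta> where "\<delta> i = (\<psi> i * \<mu> i y0 - hj (blk i) y0) / h y0" for i
  have f_sum: "f x = (\<Sum>i\<in>I. \<psi> i * \<beta> i * \<mu> i x)" for x
    unfolding span \<psi>_def using \<beta>_nonzero by (intro sum.cong) auto
  have f_xy: "f (x * y) = (\<Sum>i\<in>I. (\<psi> i * \<mu> i y) * \<beta> i * \<mu> i x)" for x y
    unfolding f_sum using mult
    by (intro sum.cong) (auto simp: nonzero_multiplicative_mult algebra_simps)
  have g_sum: "g x = (\<Sum>i\<in>I. \<delta> i * \<beta> i * \<mu> i x)" for x
  proof -
    have "g x = (f (x * y0) - (\<Sum>i\<in>I. hj (blk i) y0 * \<beta> i * \<mu> i x)) / h y0"
      using eq[of x y0] h_y0 by simp
    also have "\<dots> = (\<Sum>i\<in>I. \<delta> i * \<beta> i * \<mu> i x)"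
      unfolding f_xy \<delta>_def
      by (simp add: sum_subtractf[symmetric] sum_divide_distrib left_diff_distrib diff_divide_distrib)
    finally show ?thesis .
  qed
  have "\<psi> i * \<mu> i y = \<delta> i * h y + hj (blk i) y" if "i \<in> I" for i y
  proof -
    have "\<forall>i\<in>I. (\<psi> i * \<mu> i y) * \<beta> i = (\<delta> i * h y + hj (blk i) y) * \<beta> i"
    proof (rule coefficients_eq)
      fix x
      have "(\<Sum>i\<in>I. (\<psi> i * \<mu> i y) * \<beta> i * \<mu> i x) = f (x * y)" by (simp add: f_xy)
      also have "\<dots> = (\<Sum>i\<in>I. ((\<delta> i * h y + hj (blk i) y) * \<beta> i) * \<mu> i x)"
        unfolding eq g_sum by (simp add: sum_distrib_left sum.distrib algebra_simps)
      finally show "(\<Sum>i\<in>I. (\<psi> i * \<mu> i y) * \<beta> i * \<mu> i x)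
          = (\<Sum>i\<in>I. ((\<delta> i * h y + hj (blk i) y) * \<beta> i) * \<mu> i x)" .
    qed
    then show ?thesis using \<beta>_nonzero[OF that] that by auto
  qed
  with f_sum g_sum that show thesis by blast
qed

text \<open>Subtracting the relations of \<open>i\<close> and \<open>i'\<close> eliminates \<open>hj (blk i)\<close> and, as \<open>\<delta> i = \<delta> i'\<close>, also
  \<open>h\<close>. What remains says that \<open>\<psi> i * \<mu> i\<close> and \<open>\<psi> i' * \<mu> i'\<close> are equal.\<close>

lemma equal_coefficients:
  assumes rel: "\<And>i y. i \<in> I \<Longrightarrow> \<psi> i * \<mu> i y = \<delta> i * h y + hj (blk i) y"
    and i: "i \<in> I" "i' \<in> I" "i \<noteq> i'" "blk i = blk i'" "\<delta> i = \<delta> i'"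
  shows "\<psi> i = 0"
  using proportional_imp_zero(1)[OF i(1-3), of "\<psi> i" "\<psi> i'"] rel[OF i(1)] rel[OF i(2)] i(4,5)
  by simp

text \<open>Every index shares its block with another one, so constancy of \<open>\<delta>\<close> kills all coefficients
  \<open>\<psi> i\<close>, and the relations reduce to \<open>hj (blk i) = - \<delta> i * h\<close>.\<close>

lemma block_constant_case:
  assumes f_sum: "\<And>x. f x = (\<Sum>i\<in>I. \<psi> i * \<beta> i * \<mu> i x)"
    and g_sum: "\<And>x. g x = (\<Sum>i\<in>I. \<delta> i * \<beta> i * \<mu> i x)"
    and rel: "\<And>i y. i \<in> I \<Longrightarrow> \<psi> i * \<mu> i y = \<delta> i * h y + hj (blk i) y"
    and const: "\<And>i i'. i \<in> I \<Longrightarrow> i' \<in> I \<Longrightarrow> blk i = blk i' \<Longrightarrow> \<delta> i = \<delta> i'"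
  shows "\<exists>c. (\<forall>x. f x = 0) \<and> (\<forall>x. g x = (\<Sum>j\<in>J. c j * block_sum j x)) \<and>
    (\<forall>j\<in>J. \<forall>x. hj j x = - c j * h x)"
proof -
  define c where "c j = \<delta> (SOME i. i \<in> I \<and> blk i = j)" for j
  have c: "c (blk i) = \<delta> i" if "i \<in> I" for i
    using someI[of "\<lambda>l. l \<in> I \<and> blk l = blk i" i] that const unfolding c_def by blast
  have \<psi>0: "\<psi> i = 0" if i: "i \<in> I" for i
  proof -
    obtain i' where i': "i' \<in> I" "i \<noteq> i'" "blk i = blk i'"
      using two_in_block[OF blk_in[OF i]] by metis
    then show ?thesis using equal_coefficients[OF rel i i'] const[OF i i'(1,3)] by blast
  qed
  have "hj j x = - c j * h x" if j: "j \<in> J" for j x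
  proof -
    obtain i where i: "i \<in> I" "blk i = j" using two_in_block[OF j] by blast
    then have "0 = c j * h x + hj j x" using rel[of i x] \<psi>0 c by force
    then show ?thesis by (simp add: eq_neg_iff_add_eq_0 add.commute)
  qed
  moreover have "f x = 0" for x using f_sum \<psi>0 by simp
  moreover have "g x = (\<Sum>j\<in>J. c j * block_sum j x)" for x
    unfolding sum_block_sum_all g_sum using c by simp
  ultimately show ?thesis by blast
qed

text \<open>If \<open>\<delta>\<close> differs at two indices \<open>p\<close>, \<open>p'\<close> of one block, then \<open>h\<close> is a combination of
  \<open>\<mu> p\<close> and \<open>\<mu> p'\<close>, and for every further pair in one block the coefficients of both sides of
  \<open>(\<delta> i - \<delta> i') * h = \<psi> i * \<mu> i - \<psi> i' * \<mu> i'\<close> can be compared. At an index \<open>k\<close> where the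
  coefficient of \<open>h\<close> is nonzero this shows \<open>\<delta> i = \<delta> i'\<close> unless \<open>k\<close> is one of the two. So
  \<open>\<delta>\<close> can only jump at \<open>k\<close>, inside the block of \<open>k\<close>.\<close>

lemma jump_index:
  assumes rel: "\<And>i y. i \<in> I \<Longrightarrow> \<psi> i * \<mu> i y = \<delta> i * h y + hj (blk i) y"
    and h_y0: "h y0 \<noteq> 0"
    and p: "p \<in> I" "p' \<in> I" "blk p = blk p'" "\<delta> p \<noteq> \<delta> p'"
  obtains k \<eta> where "k \<in> I" "\<eta> k \<noteq> 0" "\<And>x. h x = (\<Sum>i\<in>I. \<eta> i * \<mu> i x)"
    "\<And>i i' l. i \<in> I \<Longrightarrow> i' \<in> I \<Longrightarrow> l \<in> I \<Longrightarrow> blk i = blk i' \<Longrightarrow>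
       (\<delta> i - \<delta> i') * \<eta> l = (if l = i then \<psi> i else 0) - (if l = i' then \<psi> i' else 0)"
    "\<And>i i'. i \<in> I \<Longrightarrow> i' \<in> I \<Longrightarrow> blk i = blk i' \<Longrightarrow> i \<noteq> k \<Longrightarrow> i' \<noteq> k \<Longrightarrow> \<delta> i = \<delta> i'"
    "\<exists>i\<in>I. blk i = blk k \<and> \<delta> i \<noteq> \<delta> k"
proof -
  have diff: "(\<delta> i - \<delta> i') * h x
      = (\<Sum>l\<in>I. ((if l = i then \<psi> i else 0) - (if l = i' then \<psi> i' else 0)) * \<mu> l x)"
    if "i \<in> I" "i' \<in> I" "blk i = blk i'" for i i' x
    unfolding left_diff_distrib[of _ _ "\<mu> _ x"] sum_subtractf single_term[OF that(1)]
      single_term[OF that(2)]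
    using rel[OF that(1)] rel[OF that(2)] that(3) by (simp add: algebra_simps)
  define \<eta> where "\<eta> l = ((if l = p then \<psi> p else 0) - (if l = p' then \<psi> p' else 0)) / (\<delta> p - \<delta> p')"
    for l
  have h_sum: "h x = (\<Sum>i\<in>I. \<eta> i * \<mu> i x)" for x
  proof -
    have "h x = (\<Sum>l\<in>I. ((if l = p then \<psi> p else 0) - (if l = p' then \<psi> p' else 0)) * \<mu> l x)
        / (\<delta> p - \<delta> p')"
      using diff[OF p(1-3), of x, symmetric] p(4) by simp
    then show ?thesis unfolding \<eta>_def by (simp add: sum_divide_distrib)
  qed
  have "\<forall>l\<in>I. (\<delta> i - \<delta> i') * \<eta> l = (if l = i then \<psi> i else 0) - (if l = i' then \<psi> i' else 0)"
    if "i \<in> I" "i' \<in> I" "blk i = blk i'" for i i'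
  proof (rule coefficients_eq)
    fix x
    show "(\<Sum>l\<in>I. (\<delta> i - \<delta> i') * \<eta> l * \<mu> l x)
      = (\<Sum>l\<in>I. ((if l = i then \<psi> i else 0) - (if l = i' then \<psi> i' else 0)) * \<mu> l x)"
      using diff[OF that, of x] by (simp add: h_sum sum_distrib_left mult.assoc)
  qed
  then have coeff: "(\<delta> i - \<delta> i') * \<eta> l = (if l = i then \<psi> i else 0) - (if l = i' then \<psi> i' else 0)"
    if "i \<in> I" "i' \<in> I" "l \<in> I" "blk i = blk i'" for i i' l
    using that by blast
  have "\<exists>k\<in>I. \<eta> k \<noteq> 0"
  proof (rule ccontr)
    assume "\<not> ?thesis"
    then have "h y0 = 0" using h_sum by simp
    with h_y0 show False by simp
  qed
  then obtain k where k: "k \<in> I" "\<eta> k \<noteq> 0" by blast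
  have const: "\<delta> i = \<delta> i'"
    if "i \<in> I" "i' \<in> I" "blk i = blk i'" "i \<noteq> k" "i' \<noteq> k" for i i'
    using coeff[OF that(1,2) k(1) that(3)] k(2) that by simp
  have "\<exists>i\<in>I. blk i = blk k \<and> \<delta> i \<noteq> \<delta> k"
    using const p by metis
  with k h_sum coeff const that show thesis by blast
qed

text \<open>The two shapes of a solution whose \<open>f\<close> is supported on a single block: \<open>p\<close> and \<open>r\<close> are the
  two elements of a block \<open>q\<close>, and \<open>k\<close> is an element of a larger one. The function \<open>e\<close> holds the
  coefficients with which \<open>g\<close> contains the sums of the other blocks.\<close>

definition pair_form :: "'j \<Rightarrow> 'i \<Rightarrow> 'i \<Rightarrow> ('j \<Rightarrow> 'k) \<Rightarrow> bool" where
  "pair_form q p r e \<longleftrightarrow> (\<exists>a b c d. c \<noteq> d \<and> (a, b) \<noteq> (0, 0) \<and>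
    (\<forall>x. f x = (d - c) * (b * \<beta> p * \<mu> p x - a * \<beta> r * \<mu> r x)) \<and>
    (\<forall>x. g x = d * \<beta> p * \<mu> p x + c * \<beta> r * \<mu> r x + (\<Sum>j\<in>J-{q}. e j * block_sum j x)) \<and>
    (\<forall>x. h x = a * \<mu> r x + b * \<mu> p x) \<and>
    (\<forall>x. hj q x = - d * a * \<mu> r x - c * b * \<mu> p x))"

definition single_form :: "'i \<Rightarrow> ('j \<Rightarrow> 'k) \<Rightarrow> bool" where
  "single_form k e \<longleftrightarrow> (\<exists>a c d. c \<noteq> d \<and> a \<noteq> 0 \<and>
    (\<forall>x. f x = a * (c - d) * \<beta> k * \<mu> k x) \<and>
    (\<forall>x. g x = d * block_sum (blk k) x + (c - d) * \<beta> k * \<mu> k x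
       + (\<Sum>j\<in>J-{blk k}. e j * block_sum j x)) \<and>
    (\<forall>x. h x = a * \<mu> k x) \<and> (\<forall>x. hj (blk k) x = - d * a * \<mu> k x))"

lemma two_element_block:
  assumes f_sum: "\<And>x. f x = (\<Sum>i\<in>I. \<psi> i * \<beta> i * \<mu> i x)"
    and g_sum: "\<And>x. g x = (\<Sum>i\<in>I. \<delta> i * \<beta> i * \<mu> i x)"
    and rel: "\<And>i y. i \<in> I \<Longrightarrow> \<psi> i * \<mu> i y = \<delta> i * h y + hj (blk i) y"
    and off: "\<And>i. i \<in> I \<Longrightarrow> blk i \<noteq> q \<Longrightarrow> \<psi> i = 0 \<and> \<delta> i = e (blk i)"
    and block: "{i\<in>I. blk i = q} = {p, r}" and "p \<noteq> r" and jump: "\<delta> p \<noteq> \<delta> r"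
    and h_y0: "h y0 \<noteq> 0"
  shows "pair_form q p r e"
proof -
  define d c where "d = \<delta> p" and "c = \<delta> r"
  \<comment> \<open>Dividing \<open>(\<delta> p - \<delta> r) * h = \<psi> p * \<mu> p - \<psi> r * \<mu> r\<close> by \<open>d - c\<close> makes these the
    coefficients of \<open>h\<close>.\<close>
  define b a where "b = \<psi> p / (d - c)" and "a = \<psi> r / (c - d)"
  have pr: "p \<in> I" "r \<in> I" "blk p = q" "blk r = q" using block by auto
  have dc: "d - c \<noteq> 0" using jump by (simp add: d_def c_def)
  have \<psi>: "\<psi> p = (d - c) * b" "\<psi> r = (c - d) * a" using dc by (auto simp: a_def b_def)
  have split: "(\<Sum>i\<in>I. F i) = F p + F r + (\<Sum>i\<in>{i\<in>I. blk i \<in> J - {q}}. F i)" for F :: "'i \<Rightarrow> 'k"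
  proof -
    have "(\<Sum>i\<in>I. F i) = (\<Sum>i\<in>{i\<in>I. blk i = q}. F i) + (\<Sum>i\<in>{i\<in>I. blk i \<in> J - {q}}. F i)"
      using finite_I blk_in by (subst sum.union_disjoint[symmetric]) (auto intro!: sum.cong)
    then show ?thesis using block \<open>p \<noteq> r\<close> by simp
  qed
  have hx: "h x = a * \<mu> r x + b * \<mu> p x" for x
  proof -
    have "(d - c) * h x = \<psi> p * \<mu> p x - \<psi> r * \<mu> r x"
      using rel[OF pr(1), of x] rel[OF pr(2), of x] pr by (simp add: d_def c_def algebra_simps)
    also have "\<dots> = (d - c) * (a * \<mu> r x + b * \<mu> p x)" by (simp add: \<psi> algebra_simps)
    finally show ?thesis using dc by simp
  qed
  have "f x = (d - c) * (b * \<beta> p * \<mu> p x - a * \<beta> r * \<mu> r x)" for x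
    unfolding f_sum split using off by (simp add: \<psi> algebra_simps)
  moreover have "g x = d * \<beta> p * \<mu> p x + c * \<beta> r * \<mu> r x + (\<Sum>j\<in>J-{q}. e j * block_sum j x)" for x
    unfolding g_sum split d_def c_def sum_block_sum[OF Diff_subset] using off
    by (auto intro!: sum.cong)
  moreover have "hj q x = - d * a * \<mu> r x - c * b * \<mu> p x" for x
  proof -
    have "hj q x = \<psi> p * \<mu> p x - d * h x" using rel[OF pr(1), of x] pr by (simp add: d_def)
    then show ?thesis unfolding hx \<psi> by (simp add: algebra_simps)
  qed
  moreover have "(a, b) \<noteq> (0, 0)" using hx[of y0] h_y0 by auto
  moreover have "c \<noteq> d" using dc by simp
  ultimately show ?thesis unfolding pair_form_def using hx by blast
qed

text \<open>With at least three indices in the block of the jump \<open>k\<close>, any other index \<open>l\<close> of the block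
  has a further companion \<open>t\<close> with \<open>\<delta> t = \<delta> l\<close>, so that \<open>\<psi> l = 0\<close>. Comparing
  coefficients at \<open>l\<close> for the pair \<open>k\<close>, \<open>t\<close> then removes \<open>\<mu> l\<close> from \<open>h\<close>, because \<open>l\<close> is neither
  \<open>k\<close> nor \<open>t\<close>.\<close>

lemma large_block:
  assumes f_sum: "\<And>x. f x = (\<Sum>i\<in>I. \<psi> i * \<beta> i * \<mu> i x)"
    and g_sum: "\<And>x. g x = (\<Sum>i\<in>I. \<delta> i * \<beta> i * \<mu> i x)"
    and rel: "\<And>i y. i \<in> I \<Longrightarrow> \<psi> i * \<mu> i y = \<delta> i * h y + hj (blk i) y"
    and off: "\<And>i. i \<in> I \<Longrightarrow> blk i \<noteq> blk k \<Longrightarrow> \<psi> i = 0 \<and> \<delta> i = e (blk i)"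
    and k: "k \<in> I" "\<eta> k \<noteq> 0" and h_sum: "\<And>x. h x = (\<Sum>i\<in>I. \<eta> i * \<mu> i x)"
    and coeff: "\<And>i i' l. i \<in> I \<Longrightarrow> i' \<in> I \<Longrightarrow> l \<in> I \<Longrightarrow> blk i = blk i' \<Longrightarrow>
       (\<delta> i - \<delta> i') * \<eta> l = (if l = i then \<psi> i else 0) - (if l = i' then \<psi> i' else 0)"
    and const: "\<And>i i'. i \<in> I \<Longrightarrow> i' \<in> I \<Longrightarrow> blk i = blk i' \<Longrightarrow> i \<noteq> k \<Longrightarrow> i' \<noteq> k \<Longrightarrow> \<delta> i = \<delta> i'"
    and jump: "\<exists>i\<in>I. blk i = blk k \<and> \<delta> i \<noteq> \<delta> k"
    and large: "card {i\<in>I. blk i = blk k} \<ge> 3"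
  shows "single_form k e"
proof -
  obtain s where s: "s \<in> I" "blk s = blk k" "\<delta> s \<noteq> \<delta> k" using jump by blast
  define d c a where "d = \<delta> s" and "c = \<delta> k" and "a = \<eta> k"
  have cd: "c \<noteq> d" using s by (simp add: c_def d_def)
  have \<delta>d: "\<delta> i = d" if "i \<in> I" "blk i = blk k" "i \<noteq> k" for i
    using const[OF that(1) s(1)] that s by (auto simp: d_def)
  have third: "\<exists>t\<in>I. blk t = blk k \<and> t \<noteq> k \<and> t \<noteq> l" for l
  proof (rule ccontr)
    assume "\<not> ?thesis"
    then have "{i\<in>I. blk i = blk k} \<subseteq> {k, l}" by blast
    then have "card {i\<in>I. blk i = blk k} \<le> card {k, l}" by (intro card_mono) auto
    also have "card {k, l} \<le> 2" by (simp add: card_insert_if)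
    finally show False using large by simp
  qed
  have \<psi>0: "\<psi> i = 0" if "i \<in> I" "i \<noteq> k" for i
  proof (cases "blk i = blk k")
    case True
    obtain t where t: "t \<in> I" "blk t = blk k" "t \<noteq> k" "t \<noteq> i" using third by blast
    show ?thesis
      using equal_coefficients[OF rel that(1) t(1)] t \<delta>d[OF that(1) True that(2)] \<delta>d[OF t(1-3)] True
      by simp
  qed (use off that in blast)
  have \<eta>0: "\<eta> l = 0" if "l \<in> I" "l \<noteq> k" for l
  proof -
    obtain t where t: "t \<in> I" "blk t = blk k" "t \<noteq> k" "t \<noteq> l" using third by blast
    have "(c - d) * \<eta> l = 0"
      using coeff[OF k(1) t(1) that(1)] t that \<delta>d[OF t(1-3)] by (simp add: c_def)
    then show ?thesis using cd by simp
  qed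
  have hx: "h x = a * \<mu> k x" for x
  proof -
    have "h x = (\<Sum>i\<in>I. if i = k then a * \<mu> k x else 0)"
      unfolding h_sum using \<eta>0 by (intro sum.cong) (auto simp: a_def)
    then show ?thesis using finite_I k by simp
  qed
  have \<psi>k: "\<psi> k = a * (c - d)"
    using coeff[OF k(1) s(1) k(1)] s by (auto simp: a_def c_def d_def mult.commute)
  have "f x = a * (c - d) * \<beta> k * \<mu> k x" for x
  proof -
    have "f x = (\<Sum>i\<in>I. if i = k then a * (c - d) * \<beta> k * \<mu> k x else 0)"
      unfolding f_sum using \<psi>0 \<psi>k by (intro sum.cong) auto
    then show ?thesis using finite_I k by simp
  qed
  moreover have "g x = d * block_sum (blk k) x + (c - d) * \<beta> k * \<mu> k x
       + (\<Sum>j\<in>J-{blk k}. e j * block_sum j x)" for x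
  proof -
    have "g x = (\<Sum>i\<in>{i\<in>I. blk i = blk k}. \<delta> i * \<beta> i * \<mu> i x)
        + (\<Sum>i\<in>{i\<in>I. blk i \<in> J - {blk k}}. \<delta> i * \<beta> i * \<mu> i x)"
      unfolding g_sum
      using finite_I blk_in by (subst sum.union_disjoint[symmetric]) (auto intro!: sum.cong)
    also have "(\<Sum>i\<in>{i\<in>I. blk i = blk k}. \<delta> i * \<beta> i * \<mu> i x)
        = (\<Sum>i\<in>{i\<in>I. blk i = blk k}. d * (\<beta> i * \<mu> i x)
            + (if i = k then (c - d) * \<beta> k * \<mu> k x else 0))"
      using \<delta>d by (intro sum.cong) (auto simp: c_def algebra_simps)
    also have "\<dots> = d * block_sum (blk k) x + (c - d) * \<beta> k * \<mu> k x"
      using finite_I k by (simp add: sum.distrib block_sum_def sum_distrib_left)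
    also have "(\<Sum>i\<in>{i\<in>I. blk i \<in> J - {blk k}}. \<delta> i * \<beta> i * \<mu> i x)
        = (\<Sum>j\<in>J-{blk k}. e j * block_sum j x)"
      unfolding sum_block_sum[OF Diff_subset] using off by (intro sum.cong) auto
    finally show ?thesis .
  qed
  moreover have "hj (blk k) x = - d * a * \<mu> k x" for x
  proof -
    have "0 = d * h x + hj (blk k) x"
      using rel[OF s(1), of x] \<psi>0[OF s(1)] s(2,3) by (cases "s = k") (simp_all add: d_def)
    then show ?thesis unfolding hx by (simp add: eq_neg_iff_add_eq_0 add.commute mult.assoc)
  qed
  moreover have "a \<noteq> 0" using k by (simp add: a_def)
  ultimately show ?thesis unfolding single_form_def using cd hx by blast
qed

text \<open>Every block other than that of \<open>k\<close> behaves as in \<open>block_constant_case\<close>. The function \<open>f\<close> is not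
  zero, because at \<open>k\<close> the coefficient of \<open>f\<close> is proportional to the size of the jump and to the
  coefficient of \<open>h\<close>.\<close>

lemma jump_case:
  assumes f_sum: "\<And>x. f x = (\<Sum>i\<in>I. \<psi> i * \<beta> i * \<mu> i x)"
    and g_sum: "\<And>x. g x = (\<Sum>i\<in>I. \<delta> i * \<beta> i * \<mu> i x)"
    and rel: "\<And>i y. i \<in> I \<Longrightarrow> \<psi> i * \<mu> i y = \<delta> i * h y + hj (blk i) y"
    and h_y0: "h y0 \<noteq> 0"
    and p: "p \<in> I" "p' \<in> I" "blk p = blk p'" "\<delta> p \<noteq> \<delta> p'"
  shows "\<exists>k\<in>I. \<exists>e. (\<exists>x. f x \<noteq> 0) \<and> (\<forall>j\<in>J - {blk k}. \<forall>x. hj j x = - e j * h x) \<and>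
    (\<forall>p r. {i\<in>I. blk i = blk k} = {p, r} \<longrightarrow> p \<noteq> r \<longrightarrow> pair_form (blk k) p r e) \<and>
    (card {i\<in>I. blk i = blk k} \<ge> 3 \<longrightarrow> single_form k e)"
proof -
  obtain k \<eta> where k: "k \<in> I" "\<eta> k \<noteq> 0" and h_sum: "\<And>x. h x = (\<Sum>i\<in>I. \<eta> i * \<mu> i x)"
    and coeff: "\<And>i i' l. i \<in> I \<Longrightarrow> i' \<in> I \<Longrightarrow> l \<in> I \<Longrightarrow> blk i = blk i' \<Longrightarrow>
       (\<delta> i - \<delta> i') * \<eta> l = (if l = i then \<psi> i else 0) - (if l = i' then \<psi> i' else 0)"
    and const: "\<And>i i'. i \<in> I \<Longrightarrow> i' \<in> I \<Longrightarrow> blk i = blk i' \<Longrightarrow> i \<noteq> k \<Longrightarrow> i' \<noteq> k \<Longrightarrow> \<delta> i = \<delta> i'"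
    and jump: "\<exists>i\<in>I. blk i = blk k \<and> \<delta> i \<noteq> \<delta> k"
    by (rule jump_index[OF rel h_y0 p]) blast+
  obtain s where s: "s \<in> I" "blk s = blk k" "\<delta> s \<noteq> \<delta> k" using jump by blast
  have "(\<delta> k - \<delta> s) * \<eta> k = \<psi> k"
    using coeff[OF k(1) s(1) k(1)] s by auto
  then have \<psi>k: "\<psi> k \<noteq> 0" using k s by auto
  have f_nonzero: "\<exists>x0. f x0 \<noteq> 0"
  proof (rule ccontr)
    assume "\<not> ?thesis"
    then have "\<forall>i\<in>I. \<psi> i * \<beta> i = 0" by (intro coefficients_zero) (simp add: f_sum)
    then show False using \<psi>k k(1) \<beta>_nonzero[OF k(1)] by auto
  qed
  define e where "e j = \<delta> (SOME i. i \<in> I \<and> blk i = j)" for j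
  have off: "\<psi> i = 0 \<and> \<delta> i = e (blk i)" if i: "i \<in> I" "blk i \<noteq> blk k" for i
  proof
    obtain i' where i': "i' \<in> I" "i \<noteq> i'" "blk i = blk i'"
      using two_in_block[OF blk_in[OF i(1)]] by metis
    have "\<delta> i = \<delta> i'" using const[OF i(1) i'(1) i'(3)] i i' by metis
    then show "\<psi> i = 0" using equal_coefficients[OF rel i(1) i'] by blast
    have "(SOME l. l \<in> I \<and> blk l = blk i) \<in> I \<and> blk (SOME l. l \<in> I \<and> blk l = blk i) = blk i"
      using i someI[of "\<lambda>l. l \<in> I \<and> blk l = blk i" i] by blast
    then show "\<delta> i = e (blk i)" unfolding e_def using const i by metis
  qed
  have hj_e: "hj j x = - e j * h x" if j: "j \<in> J - {blk k}" for j x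
  proof -
    obtain i where i: "i \<in> I" "blk i = j" using two_in_block j by blast
    then have "0 = e j * h x + hj j x" using rel[of i x] off[of i] j by auto
    then show ?thesis by (simp add: eq_neg_iff_add_eq_0 add.commute)
  qed
  have small: "pair_form (blk k) p r e" if block: "{i\<in>I. blk i = blk k} = {p, r}" and ne: "p \<noteq> r" for p r
  proof -
    have "s \<in> {p, r}" "k \<in> {p, r}" unfolding block[symmetric] using s k by auto
    then have pr: "\<delta> p \<noteq> \<delta> r" using s(3) by auto
    show ?thesis
      by (rule two_element_block[where \<psi> = \<psi> and \<delta> = \<delta>,
            OF f_sum g_sum rel off block ne pr h_y0])
  qed
  have large: "single_form k e" if card: "card {i\<in>I. blk i = blk k} \<ge> 3"
    by (rule large_block[where \<psi> = \<psi> and \<delta> = \<delta> and \<eta> = \<eta>,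
          OF f_sum g_sum rel off k h_sum coeff const jump card])
  show ?thesis
    using f_nonzero hj_e small large by (intro bexI[OF _ k(1)] exI[of _ e]) blast
qed

text \<open>The block of the jump can be recovered from \<open>f\<close> alone, which gives its uniqueness.\<close>

lemma supporting_block_unique:
  assumes "\<And>x. f x = (\<Sum>i\<in>{i\<in>I. blk i = q}. \<phi> i * \<mu> i x)"
    and "\<And>x. f x = (\<Sum>i\<in>{i\<in>I. blk i = q'}. \<phi>' i * \<mu> i x)"
    and "f x0 \<noteq> 0"
  shows "q = q'"
proof (rule ccontr)
  assume ne: "q \<noteq> q'"
  have ext: "(\<Sum>i\<in>{i\<in>I. blk i = j}. \<omega> i * \<mu> i x) = (\<Sum>i\<in>I. (if blk i = j then \<omega> i else 0) * \<mu> i x)"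
    for j \<omega> x
    using finite_I by (intro sum.mono_neutral_cong_left) auto
  have "\<forall>i\<in>I. (if blk i = q then \<phi> i else 0) = (if blk i = q' then \<phi>' i else 0)"
    by (rule coefficients_eq) (simp only: ext[symmetric] assms(1,2)[symmetric])
  then have "\<phi> i = 0" if "i \<in> I" "blk i = q" for i
    using that ne by metis
  then have "f x0 = 0" unfolding assms(1) by simp
  with assms(3) show False by simp
qed

end

section \<open>Consecutive intervals\<close>

text \<open>The intervals are consecutive, so \<open>i\<close> lies in the first one whose right end reaches \<open>i\<close>.\<close>

lemma interval_index:
  fixes lo hi :: "nat \<Rightarrow> nat"
  assumes lo_first: "lo 1 = 1"
    and consecutive: "\<And>j. j \<in> {1..n-1} \<Longrightarrow> lo (j + 1) = hi j + 1"
    and nonempty: "\<And>j. j \<in> {1..n} \<Longrightarrow> lo j \<le> hi j"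
    and "n \<ge> 1"
  obtains blk where "\<And>i. i \<in> {1..hi n} \<Longrightarrow> blk i \<in> {1..n}"
    "\<And>j. j \<in> {1..n} \<Longrightarrow> {i \<in> {1..hi n}. blk i = j} = {lo j..hi j}"
proof -
  define blk where "blk i = (LEAST j. 1 \<le> j \<and> i \<le> hi j)" for i
  have step: "hi j < hi (Suc j)" if "1 \<le> j" "Suc j \<le> n" for j
    using consecutive[of j] nonempty[of "Suc j"] that by auto
  have hi_less: "hi j < hi j'" if "1 \<le> j" "j < j'" "j' \<le> n" for j j'
    using that(2,3)
  proof (induction j')
    case (Suc j')
    then show ?case
      using step[of j'] that(1) by (cases "j = j'") auto
  qed simp
  have blk: "1 \<le> blk i" "i \<le> hi (blk i)" "blk i \<le> n" if "i \<in> {1..hi n}" for i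
  proof -
    have ex: "1 \<le> n \<and> i \<le> hi n" using that \<open>n \<ge> 1\<close> by simp
    show "blk i \<le> n" unfolding blk_def using ex by (rule Least_le)
    have "1 \<le> blk i \<and> i \<le> hi (blk i)" unfolding blk_def using ex by (rule LeastI)
    then show "1 \<le> blk i" "i \<le> hi (blk i)" by auto
  qed
  have lo_blk: "lo (blk i) \<le> i" if i: "i \<in> {1..hi n}" for i
  proof (cases "blk i = 1")
    case True
    then show ?thesis using lo_first i by simp
  next
    case False
    then have "1 \<le> blk i - 1" "blk i - 1 < blk i" using blk(1)[OF i] by auto
    then have "hi (blk i - 1) < i"
      using not_less_Least[of "blk i - 1" "\<lambda>j. 1 \<le> j \<and> i \<le> hi j"] unfolding blk_def[symmetric]
      by auto
    moreover have "lo (blk i) = hi (blk i - 1) + 1"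
      using consecutive[of "blk i - 1"] False blk(1)[OF i] diff_le_mono[OF blk(3)[OF i], of 1] by auto
    ultimately show ?thesis by simp
  qed
  have lo_prev: "hi j' < lo j" if "1 \<le> j'" "j' < j" "j \<le> n" for j j'
  proof -
    have "lo j = hi (j - 1) + 1" using consecutive[of "j - 1"] that diff_le_mono[OF that(3), of 1] by auto
    moreover have "hi j' \<le> hi (j - 1)"
    proof (cases "j' = j - 1")
      case False
      then have "j' < j - 1" "j - 1 \<le> n" using that by linarith+
      then show ?thesis using hi_less[of j' "j - 1"] that(1) by simp
    qed simp
    ultimately show ?thesis by simp
  qed
  have blk_eq: "i \<in> {1..hi n} \<and> blk i = j" if j: "j \<in> {1..n}" and i: "i \<in> {lo j..hi j}" for i j
  proof -
    have "lo j \<ge> 1" using lo_first lo_prev[of 1 j] j by (cases "j = 1") auto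
    moreover have "hi j \<le> hi n" using hi_less[of j n] j by (cases "j = n") auto
    ultimately have in_range: "i \<in> {1..hi n}" using i by auto
    have "blk i = j"
    proof (rule linorder_cases)
      assume "blk i < j"
      then show ?thesis using lo_prev[of "blk i" j] blk[OF in_range] i j by auto
    next
      assume "blk i > j"
      then show ?thesis using lo_prev[of j "blk i"] blk[OF in_range] lo_blk[OF in_range] i j by auto
    qed
    with in_range show ?thesis by simp
  qed
  show thesis
  proof (rule that)
    show "blk i \<in> {1..n}" if "i \<in> {1..hi n}" for i using blk[OF that] by simp
    show "{i \<in> {1..hi n}. blk i = j} = {lo j..hi j}" if "j \<in> {1..n}" for j
    proof
      show "{i \<in> {1..hi n}. blk i = j} \<subseteq> {lo j..hi j}"
        using blk(2) lo_blk by (simp add: subset_iff) blast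
      show "{lo j..hi j} \<subseteq> {i \<in> {1..hi n}. blk i = j}"
        using blk_eq[OF that] by blast
    qed
  qed
qed

section \<open>The classification\<close>

theorem theorem2p6:
  fixes \<mu> :: "nat \<Rightarrow> 'm::monoid_mult \<Rightarrow> 'k::field"
    and \<beta> :: "nat \<Rightarrow> 'k"
    and m n :: nat
    and lo hi :: "nat \<Rightarrow> nat"
    and gj hj :: "nat \<Rightarrow> 'm \<Rightarrow> 'k"
    and f g h :: "'m \<Rightarrow> 'k"
  assumes n_ge_2: "n \<ge> 2"
    and mult: "\<forall>i\<in>{1..m}. nonzero_multiplicative (\<mu> i)"
    and dist: "inj_on \<mu> {1..m}"
    and coeff_nonzero: "\<forall>i\<in>{1..m}. \<beta> i \<noteq> 0"
    and lo_first: "lo 1 = 1"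
    and consecutive: "\<forall>j\<in>{1..n-1}. lo (j + 1) = hi j + 1"
    and hi_last: "hi n = m"
    and at_least_two: "\<forall>j\<in>{1..n}. hi j - lo j \<ge> 1"
    and gj: "\<forall>j\<in>{1..n}. gj j = (\<lambda>x. \<Sum>i=lo j..hi j. \<beta> i * \<mu> i x)"
    and eq: "\<forall>x y. f (x * y) = g x * h y + (\<Sum>j=1..n. gj j x * hj j y)"
  shows
   "(\<exists>\<chi> a b c.
        nonzero_multiplicative \<chi> \<and> (\<forall>i\<in>{1..m}. \<chi> \<noteq> \<mu> i) \<and> a \<noteq> 0 \<and> b \<noteq> 0 \<and>
        f = (\<lambda>x. a * b * \<chi> x) \<and>
        g = (\<lambda>x. b * \<chi> x - (\<Sum>k=1..n. c k * gj k x)) \<and>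
        h = (\<lambda>x. a * \<chi> x) \<and>
        (\<forall>j\<in>{1..n}. hj j = (\<lambda>x. a * c j * \<chi> x)))
    \<or>
    (\<exists>!q. q \<in> {1..n} \<and>
      (\<exists>(a::'k) (b::'k) (c::'k) (d::'k) (cj::nat \<Rightarrow> 'k).
        c \<noteq> d \<and> (a, b) \<noteq> (0, 0) \<and>
        (hi q - lo q = 1 \<longrightarrow>
          f = (\<lambda>x. (d - c) * (b * \<beta> (lo q) * \<mu> (lo q) x - a * \<beta> (hi q) * \<mu> (hi q) x)) \<and>
          g = (\<lambda>x. d * \<beta> (lo q) * \<mu> (lo q) x + c * \<beta> (hi q) * \<mu> (hi q) x
                     + (\<Sum>j\<in>{1..n}-{q}. cj j * gj j x)) \<and>
          h = (\<lambda>x. a * \<mu> (hi q) x + b * \<mu> (lo q) x) \<and>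
          hj q = (\<lambda>x. - d * a * \<mu> (hi q) x - c * b * \<mu> (lo q) x) \<and>
          (\<forall>j\<in>{1..n}-{q}. hj j = (\<lambda>x. - cj j * a * \<mu> (hi q) x - cj j * b * \<mu> (lo q) x))) \<and>
        (hi q - lo q \<ge> 2 \<longrightarrow>
          a \<noteq> 0 \<and>
          (\<exists>k\<in>{lo q..hi q}.
            f = (\<lambda>x. a * (c - d) * \<beta> k * \<mu> k x) \<and>
            g = (\<lambda>x. d * gj q x + (c - d) * \<beta> k * \<mu> k x + (\<Sum>j\<in>{1..n}-{q}. cj j * gj j x)) \<and>
            h = (\<lambda>x. a * \<mu> k x) \<and>
            hj q = (\<lambda>x. - d * a * \<mu> k x) \<and>
            (\<forall>j\<in>{1..n}-{q}. hj j = (\<lambda>x. - cj j * a * \<mu> k x))))))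
    \<or>
    (\<exists>c.
        f = (\<lambda>x. 0) \<and>
        g = (\<lambda>x. \<Sum>k=1..n. c k * gj k x) \<and>
        h \<noteq> (\<lambda>x. 0) \<and>
        (\<forall>j\<in>{1..n}. hj j = (\<lambda>x. - c j * h x)))
    \<or>
    (f = (\<lambda>x. 0) \<and> h = (\<lambda>x. 0) \<and> (\<forall>j\<in>{1..n}. hj j = (\<lambda>x. 0)))"
proof -
  have lo_less_hi: "lo j < hi j" if "j \<in> {1..n}" for j
    using at_least_two[rule_format, OF that] by simp
  obtain blk where blk_in: "\<And>i. i \<in> {1..hi n} \<Longrightarrow> blk i \<in> {1..n}"
    and blk: "\<And>j. j \<in> {1..n} \<Longrightarrow> {i \<in> {1..hi n}. blk i = j} = {lo j..hi j}"
  proof (rule interval_index[of lo n hi])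
    show "lo 1 = 1" by (rule lo_first)
    show "lo (j + 1) = hi j + 1" if "j \<in> {1..n-1}" for j using consecutive that by blast
    show "lo j \<le> hi j" if "j \<in> {1..n}" for j using lo_less_hi[OF that] by simp
    show "n \<ge> 1" using n_ge_2 by simp
  qed (rule that)
  have blk: "{i \<in> {1..m}. blk i = j} = {lo j..hi j}" if "j \<in> {1..n}" for j
    using blk[OF that] hi_last by simp
  have blk_in: "blk i \<in> {1..n}" if "i \<in> {1..m}" for i
    using blk_in that hi_last by simp
  have sum_blocks: "(\<Sum>j=1..n. gj j x * hj j y) = (\<Sum>i\<in>{1..m}. hj (blk i) y * \<beta> i * \<mu> i x)" for x y
  proof -
    have "(\<Sum>i\<in>{1..m}. hj (blk i) y * \<beta> i * \<mu> i x)
        = (\<Sum>j\<in>{1..n}. \<Sum>i\<in>{i \<in> {1..m}. blk i = j}. hj (blk i) y * \<beta> i * \<mu> i x)"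
      using blk_in by (intro sum.group[symmetric]) auto
    also have "\<dots> = (\<Sum>j=1..n. gj j x * hj j y)"
    proof (rule sum.cong[OF refl])
      fix j assume j: "j \<in> {1..n}"
      have "(\<Sum>i\<in>{i \<in> {1..m}. blk i = j}. hj (blk i) y * \<beta> i * \<mu> i x)
          = (\<Sum>i\<in>{i \<in> {1..m}. blk i = j}. \<beta> i * \<mu> i x * hj j y)"
        by (intro sum.cong) auto
      then show "(\<Sum>i\<in>{i \<in> {1..m}. blk i = j}. hj (blk i) y * \<beta> i * \<mu> i x) = gj j x * hj j y"
        using gj j by (simp only: blk sum_distrib_right)
    qed
    finally show ?thesis by simp
  qed
  interpret block_equation "{1..m}" "{1..n}" blk \<mu> \<beta> f g h hj
  proof
    show "\<exists>i\<in>{1..m}. \<exists>i'\<in>{1..m}. i \<noteq> i' \<and> blk i = j \<and> blk i' = j" if "j \<in> {1..n}" for j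
    proof -
      have "lo j \<in> {i \<in> {1..m}. blk i = j}" "hi j \<in> {i \<in> {1..m}. blk i = j}"
        unfolding blk[OF that] using lo_less_hi[OF that] by auto
      then show ?thesis using lo_less_hi[OF that] less_imp_neq by blast
    qed
    show "f (x * y) = g x * h y + (\<Sum>i\<in>{1..m}. hj (blk i) y * \<beta> i * \<mu> i x)" for x y
      using eq sum_blocks by simp
  qed (use mult dist coeff_nonzero blk_in in auto)
  have block_sum: "block_sum j x = gj j x" if "j \<in> {1..n}" for j x
    unfolding block_sum_def using blk[OF that] gj that by simp
  have block_sums: "(\<Sum>j\<in>S. c j * block_sum j x) = (\<Sum>j\<in>S. c j * gj j x)"
    if "S \<subseteq> {1..n}" for S c x
  proof (rule sum.cong[OF refl])
    fix j assume "j \<in> S"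
    then have "j \<in> {1..n}" using that by blast
    then show "c j * block_sum j x = c j * gj j x" by (simp only: block_sum)
  qed
  show ?thesis (is "?case1 \<or> (\<exists>!q. q \<in> {1..n} \<and> ?form q) \<or> ?case3 \<or> ?case4")
  proof (cases "\<exists>\<phi>. \<forall>x. f x = (\<Sum>i\<in>{1..m}. \<phi> i * \<mu> i x)")
    case False
    then have out: "\<not> (\<forall>x. f x = (\<Sum>i\<in>{1..m}. \<phi> i * \<mu> i x))" for \<phi> by blast
    obtain \<chi> a b c where "nonzero_multiplicative \<chi>" "\<forall>i\<in>{1..m}. \<chi> \<noteq> \<mu> i" "a \<noteq> 0" "b \<noteq> 0"
      "\<forall>x. f x = a * b * \<chi> x" "\<forall>x. g x = b * \<chi> x - (\<Sum>j\<in>{1..n}. c j * block_sum j x)"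
      "\<forall>x. h x = a * \<chi> x" "\<forall>j\<in>{1..n}. \<forall>x. hj j x = a * c j * \<chi> x"
      using outside_span[OF out] by (elim exE conjE) (rule that)
    then have ?case1
      unfolding block_sums[OF subset_refl]
      by - (rule exI[of _ \<chi>], rule exI[of _ a], rule exI[of _ b], rule exI[of _ c], simp add: fun_eq_iff)
    then show ?thesis by (rule disjI1)
  next
    case True
    then obtain \<phi> where span: "\<And>x. f x = (\<Sum>i\<in>{1..m}. \<phi> i * \<mu> i x)" by blast
    show ?thesis
    proof (cases "\<exists>y0. h y0 \<noteq> 0")
      case False
      then have h0: "h x = 0" for x by simp
      have ?case4 using in_span_h_zero[OF span h0] h0 by (auto simp: fun_eq_iff)
      then show ?thesis by (rule disjI2[OF disjI2[OF disjI2]])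
    next
      case True
      then obtain y0 where h_y0: "h y0 \<noteq> 0" by blast
      obtain \<psi> \<delta> where f_sum: "\<And>x. f x = (\<Sum>i\<in>{1..m}. \<psi> i * \<beta> i * \<mu> i x)"
        and g_sum: "\<And>x. g x = (\<Sum>i\<in>{1..m}. \<delta> i * \<beta> i * \<mu> i x)"
        and rel: "\<And>i y. i \<in> {1..m} \<Longrightarrow> \<psi> i * \<mu> i y = \<delta> i * h y + hj (blk i) y"
        using in_span_coefficients[OF span h_y0] by blast
      show ?thesis
      proof (cases "\<exists>p\<in>{1..m}. \<exists>p'\<in>{1..m}. blk p = blk p' \<and> \<delta> p \<noteq> \<delta> p'")
        case False
        then have const: "\<delta> i = \<delta> i'" if "i \<in> {1..m}" "i' \<in> {1..m}" "blk i = blk i'" for i i'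
          using that by blast
        have "\<exists>c. (\<forall>x. f x = 0) \<and> (\<forall>x. g x = (\<Sum>j\<in>{1..n}. c j * block_sum j x)) \<and>
          (\<forall>j\<in>{1..n}. \<forall>x. hj j x = - c j * h x)"
          using f_sum g_sum rel const by (rule block_constant_case[where \<psi> = \<psi> and \<delta> = \<delta>])
        then obtain c where "\<forall>x. f x = 0" "\<forall>x. g x = (\<Sum>j\<in>{1..n}. c j * block_sum j x)"
          "\<forall>j\<in>{1..n}. \<forall>x. hj j x = - c j * h x"
          by (elim exE conjE) (rule that)
        then have ?case3
          using h_y0 unfolding block_sums[OF subset_refl]
          by (intro exI[of _ c]) (auto simp: fun_eq_iff)
        then show ?thesis by (rule disjI2[OF disjI2[OF disjI1]])
      next
        case True
        then obtain p p' where p: "p \<in> {1..m}" "p' \<in> {1..m}" "blk p = blk p'" "\<delta> p \<noteq> \<delta> p'"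
          by blast
        have "\<exists>k\<in>{1..m}. \<exists>e. (\<exists>x. f x \<noteq> 0) \<and>
          (\<forall>j\<in>{1..n} - {blk k}. \<forall>x. hj j x = - e j * h x) \<and>
          (\<forall>p r. {i\<in>{1..m}. blk i = blk k} = {p, r} \<longrightarrow> p \<noteq> r \<longrightarrow> pair_form (blk k) p r e) \<and>
          (card {i\<in>{1..m}. blk i = blk k} \<ge> 3 \<longrightarrow> single_form k e)"
          using f_sum g_sum rel h_y0 p by (rule jump_case[where \<psi> = \<psi> and \<delta> = \<delta>])
        then obtain k e x0 where k: "k \<in> {1..m}" and x0: "f x0 \<noteq> 0"
          and hj_e: "\<forall>j\<in>{1..n} - {blk k}. \<forall>x. hj j x = - e j * h x"
          and small: "\<forall>p r. {i\<in>{1..m}. blk i = blk k} = {p, r} \<longrightarrow> p \<noteq> r \<longrightarrow> pair_form (blk k) p r e"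
          and large: "card {i\<in>{1..m}. blk i = blk k} \<ge> 3 \<longrightarrow> single_form k e"
          by (elim bexE exE conjE) (rule that)
        have q: "blk k \<in> {1..n}" using blk_in[OF k] .
        have k_block: "k \<in> {lo (blk k)..hi (blk k)}" using blk[OF q] k by blast
        have form: "?form (blk k)"
        proof (cases "hi (blk k) - lo (blk k) = 1")
          case True
          then have two: "{i\<in>{1..m}. blk i = blk k} = {lo (blk k), hi (blk k)}"
            unfolding blk[OF q] by auto
          obtain a b c d where "c \<noteq> d" "(a, b) \<noteq> (0, 0)"
            and f: "\<forall>x. f x = (d - c) * (b * \<beta> (lo (blk k)) * \<mu> (lo (blk k)) x
              - a * \<beta> (hi (blk k)) * \<mu> (hi (blk k)) x)"
            and g: "\<forall>x. g x = d * \<beta> (lo (blk k)) * \<mu> (lo (blk k)) x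
              + c * \<beta> (hi (blk k)) * \<mu> (hi (blk k)) x
              + (\<Sum>j\<in>{1..n}-{blk k}. e j * block_sum j x)"
            and h: "\<forall>x. h x = a * \<mu> (hi (blk k)) x + b * \<mu> (lo (blk k)) x"
            and hq: "\<forall>x. hj (blk k) x
              = - d * a * \<mu> (hi (blk k)) x - c * b * \<mu> (lo (blk k)) x"
            using small[rule_format, OF two less_imp_neq[OF lo_less_hi[OF q]]] unfolding pair_form_def
            by (elim exE conjE) (rule that)
          moreover have "\<forall>j\<in>{1..n}-{blk k}. hj j = (\<lambda>x. - e j * a * \<mu> (hi (blk k)) x
              - e j * b * \<mu> (lo (blk k)) x)"
            using hj_e h by (auto simp: fun_eq_iff algebra_simps)
          ultimately show ?thesis
            using True unfolding block_sums[OF Diff_subset]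
            by - (rule exI[of _ a], rule exI[of _ b], rule exI[of _ c], rule exI[of _ d],
                rule exI[of _ e], simp add: fun_eq_iff)
        next
          case False
          then have "hi (blk k) - lo (blk k) \<ge> 2" using lo_less_hi[OF q] by auto
          then have card: "card {i\<in>{1..m}. blk i = blk k} \<ge> 3" unfolding blk[OF q] by simp
          obtain a c d where acd: "c \<noteq> d" "a \<noteq> 0"
            and f: "\<forall>x. f x = a * (c - d) * \<beta> k * \<mu> k x"
            and g: "\<forall>x. g x = d * block_sum (blk k) x + (c - d) * \<beta> k * \<mu> k x
               + (\<Sum>j\<in>{1..n}-{blk k}. e j * block_sum j x)"
            and h: "\<forall>x. h x = a * \<mu> k x" and hq: "\<forall>x. hj (blk k) x = - d * a * \<mu> k x"
            using large[rule_format, OF card] unfolding single_form_def by (elim exE conjE) (rule that)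
          have hj': "\<forall>j\<in>{1..n}-{blk k}. hj j = (\<lambda>x. - e j * a * \<mu> k x)"
            using hj_e h by (auto simp: fun_eq_iff)
          \<comment> \<open>Since \<open>a\<close> is nonzero, the pair \<open>(a, b)\<close> is nonzero for the choice \<open>b = 0\<close>.\<close>
          show ?thesis
          proof (rule exI[of _ a], rule exI[of _ 0], rule exI[of _ c], rule exI[of _ d],
              rule exI[of _ e], intro conjI impI bexI[OF _ k_block])
            show "f = (\<lambda>x. a * (c - d) * \<beta> k * \<mu> k x)"
              and "h = (\<lambda>x. a * \<mu> k x)" and "hj (blk k) = (\<lambda>x. - d * a * \<mu> k x)"
              using f h hq by blast+
            show "g = (\<lambda>x. d * gj (blk k) x + (c - d) * \<beta> k * \<mu> k x
                + (\<Sum>j\<in>{1..n} - {blk k}. e j * gj j x))"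
              using g unfolding block_sums[OF Diff_subset] block_sum[OF q] by blast
          qed (use False acd hj' in simp_all)
        qed
        \<comment> \<open>For uniqueness: whichever \<open>q'\<close> admits the stated form, that form writes \<open>f\<close> in terms of
          the block \<open>q'\<close> alone.\<close>
        have support: "\<exists>\<omega>. \<forall>x. f x = (\<Sum>i\<in>{i\<in>{1..m}. blk i = q'}. \<omega> i * \<mu> i x)"
          if q': "q' \<in> {1..n}" "?form q'" for q'
        proof (cases "hi q' - lo q' = 1")
          case True
          then have two: "{i\<in>{1..m}. blk i = q'} = {lo q', hi q'}"
            unfolding blk[OF q'(1)] by auto
          obtain a b c d :: 'k where
            f: "f = (\<lambda>x. (d - c) * (b * \<beta> (lo q') * \<mu> (lo q') x - a * \<beta> (hi q') * \<mu> (hi q') x))"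
            using q'(2) True by blast
          show ?thesis
            unfolding two using f lo_less_hi[OF q'(1)]
            by (intro exI[of _ "\<lambda>i. if i = lo q' then (d - c) * (b * \<beta> i) else - (d - c) * (a * \<beta> i)"])
              (simp add: algebra_simps)
        next
          case False
          then have "hi q' - lo q' \<ge> 2" using lo_less_hi[OF q'(1)] by auto
          then obtain a c d :: 'k and l where l: "l \<in> {lo q'..hi q'}"
            and f: "f = (\<lambda>x. a * (c - d) * \<beta> l * \<mu> l x)"
            using q'(2) by blast
          have "f x = (\<Sum>i\<in>{i\<in>{1..m}. blk i = q'}. (if i = l then a * (c - d) * \<beta> l else 0) * \<mu> i x)"
            for x
          proof -
            have "f x = (\<Sum>i\<in>{lo q'..hi q'}. if i = l then a * (c - d) * \<beta> l * \<mu> l x else 0)"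
              using l by (simp add: f)
            also have "\<dots> = (\<Sum>i\<in>{i\<in>{1..m}. blk i = q'}.
                (if i = l then a * (c - d) * \<beta> l else 0) * \<mu> i x)"
              unfolding blk[OF q'(1)] by (rule sum.cong) auto
            finally show ?thesis .
          qed
          then show ?thesis
            by (intro exI[of _ "\<lambda>i. if i = l then a * (c - d) * \<beta> l else 0"] allI)
        qed
        have "\<exists>!q. q \<in> {1..n} \<and> ?form q"
        proof (rule ex1I[of _ "blk k"])
          show "blk k \<in> {1..n} \<and> ?form (blk k)" using q form by (rule conjI)
          fix q' assume q': "q' \<in> {1..n} \<and> ?form q'"
          obtain \<omega> where "\<forall>x. f x = (\<Sum>i\<in>{i\<in>{1..m}. blk i = q'}. \<omega> i * \<mu> i x)"
            using support[OF conjunct1[OF q'] conjunct2[OF q']] by blast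
          moreover obtain \<omega>' where "\<forall>x. f x = (\<Sum>i\<in>{i\<in>{1..m}. blk i = blk k}. \<omega>' i * \<mu> i x)"
            using support[OF q form] by blast
          ultimately show "q' = blk k"
            using supporting_block_unique[of \<omega> q' \<omega>' "blk k"] x0 by blast
        qed
        then show ?thesis by (rule disjI2[OF disjI1])
      qed
    qed
  qed
qed

end
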